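(* Let $\Lambda\in\{\mathsf{MSO},\mathsf{FO(TC^1)},\mathsf{FO(LFP^1)}\}$, let $\mathfrak M$ be a $\Lambda$-Henkin structure and let $A\in\mathbb A_{\mathfrak M}$ be parametrically definable in $\mathfrak M$. Then the $\Lambda$-substructure $\mathfrak M\upharpoonright A$ is a $\Lambda$-Henkin structure.
   Context: Logics over a purely relational vocabulary: $\mathsf{MSO}$ (first-order logic plus set variables, atoms $Xx$, quantifiers $\exists X$), $\mathsf{FO(TC^1)}$ (plus formulas $[TC_{xy}\varphi](u,v)$), $\mathsf{FO(LFP^1)}$ (plus set variables and $[LFP_{Xx}\varphi]y$ with $\varphi$ positive in $X$). Henkin semantics: a frame is a relational structure $\mathfrak M$ with a set $\mathbb A_{\mathfrak M}\subseteq\wp(dom(\mathfrak M))$ of admissible subsets; set variables take admissible values; $\exists X$ ranges over $\mathbb A_{\mathfrak M}$; $[TC_{xy}\varphi](u,v)$ holds iff $g(v)$ lies in every $B\in\mathbb A_{\mathfrak M}$ containing $g(u)$ and closed under $\varphi$; $[LFP_{Xx}\varphi]y$ holds iff $g(y)\in B$ for every $B\in\mathbb A_{\mathfrak M}$ such that every $a$ with $\mathfrak M,g[a/x,B/X]\models\varphi$ lies in $B$. A $\Lambda$-Henkin structure is a frame such that for every $\Lambda$-formula $\varphi$ and assignment $g$, the set $\{a:\mathfrak M,g[a/x]\models\varphi\}$ (a parametrically definable set) belongs to $\mathbb A_{\mathfrak M}$. The $\Lambda$-substructure $\mathfrak M\upharpoonright A$ has domain $A$, the relations of $\mathfrak M$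 restricted to $A$, and admissible sets $\{X\cap A:X\in\mathbb A_{\mathfrak M}\}$. *)

theory Defs
  imports Main
begin

datatype logic = MSO | FO_TC | FO_LFP

text \<open>
  Formulas of all three logics, over relation symbols of type \<open>'r\<close>. First-order variables and
  set variables are two separate copies of \<open>nat\<close>. The remaining connectives and quantifiers are
  the usual abbreviations in terms of \<open>Neg\<close>, \<open>Conj\<close>, \<open>Ex\<close> and \<open>ExSet\<close>.
\<close>

datatype 'r fm =
    Rel 'r "nat list"
  | Eq nat nat
  | Mem nat nat                    \<comment> \<open>\<open>Mem X x\<close> is the atom \<open>Xx\<close>\<close>
  | Neg "'r fm"
  | Conj "'r fm" "'r fm"
  | Ex nat "'r fm"
  | ExSet nat "'r fm"
  | TC nat nat "'r fm" nat nat     \<comment> \<open>\<open>TC x y \<phi> u v\<close> is \<open>[TC\<^sub>x\<^sub>y \<phi>](u,v)\<close>\<close>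
  | LFP nat nat "'r fm" nat        \<comment> \<open>\<open>LFP X x \<phi> y\<close> is \<open>[LFP\<^sub>X\<^sub>x \<phi>]y\<close>\<close>

text \<open>
  \<open>polarity b X \<phi>\<close>: every free occurrence of the set variable \<open>X\<close> in \<open>\<phi>\<close> lies under an even
  (\<open>b = True\<close>) resp. odd (\<open>b = False\<close>) number of negations.
\<close>

primrec polarity :: "bool \<Rightarrow> nat \<Rightarrow> 'r fm \<Rightarrow> bool" where
  "polarity b X (Rel r xs) \<longleftrightarrow> True"
| "polarity b X (Eq x y) \<longleftrightarrow> True"
| "polarity b X (Mem Y x) \<longleftrightarrow> (Y = X \<longrightarrow> b)"
| "polarity b X (Neg \<phi>) \<longleftrightarrow> polarity (\<not> b) X \<phi>"
| "polarity b X (Conj \<phi> \<psi>) \<longleftrightarrow> polarity b X \<phi> \<and> polarity b X \<psi>"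
| "polarity b X (Ex x \<phi>) \<longleftrightarrow> polarity b X \<phi>"
| "polarity b X (ExSet Y \<phi>) \<longleftrightarrow> Y = X \<or> polarity b X \<phi>"
| "polarity b X (TC x y \<phi> u v) \<longleftrightarrow> polarity b X \<phi>"
| "polarity b X (LFP Y x \<phi> y) \<longleftrightarrow> Y = X \<or> polarity b X \<phi>"

abbreviation positive_in :: "nat \<Rightarrow> 'r fm \<Rightarrow> bool" where
  "positive_in X \<phi> \<equiv> polarity True X \<phi>"

text \<open>The formulas of a logic over the relational vocabulary with arity function \<open>ar\<close>.\<close>

primrec is_formula :: "('r \<Rightarrow> nat) \<Rightarrow> logic \<Rightarrow> 'r fm \<Rightarrow> bool" where
  "is_formula ar \<Lambda> (Rel r xs) \<longleftrightarrow> length xs = ar r"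
| "is_formula ar \<Lambda> (Eq x y) \<longleftrightarrow> True"
| "is_formula ar \<Lambda> (Mem X x) \<longleftrightarrow> \<Lambda> = MSO \<or> \<Lambda> = FO_LFP"
| "is_formula ar \<Lambda> (Neg \<phi>) \<longleftrightarrow> is_formula ar \<Lambda> \<phi>"
| "is_formula ar \<Lambda> (Conj \<phi> \<psi>) \<longleftrightarrow> is_formula ar \<Lambda> \<phi> \<and> is_formula ar \<Lambda> \<psi>"
| "is_formula ar \<Lambda> (Ex x \<phi>) \<longleftrightarrow> is_formula ar \<Lambda> \<phi>"
| "is_formula ar \<Lambda> (ExSet X \<phi>) \<longleftrightarrow> \<Lambda> = MSO \<and> is_formula ar \<Lambda> \<phi>"
| "is_formula ar \<Lambda> (TC x y \<phi> u v) \<longleftrightarrow> \<Lambda> = FO_TC \<and> x \<noteq> y \<and> is_formula ar \<Lambda> \<phi>"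
| "is_formula ar \<Lambda> (LFP X x \<phi> y) \<longleftrightarrow> \<Lambda> = FO_LFP \<and> positive_in X \<phi> \<and> is_formula ar \<Lambda> \<phi>"

record ('r, 'a) frame =
  domain :: "'a set"
  interp :: "'r \<Rightarrow> 'a list set"
  admissible :: "'a set set"

text \<open>
  The domain may be empty, so that restricting to the (always definable) empty set is not a
  special case.
\<close>

definition is_frame :: "('r \<Rightarrow> nat) \<Rightarrow> ('r, 'a) frame \<Rightarrow> bool" where
  "is_frame ar M \<longleftrightarrow>
     (\<forall>r. interp M r \<subseteq> {as. length as = ar r \<and> set as \<subseteq> domain M}) \<and>
     admissible M \<subseteq> Pow (domain M)"

primrec sat :: "('r, 'a) frame \<Rightarrow> (nat \<Rightarrow> 'a) \<Rightarrow> (nat \<Rightarrow> 'a set) \<Rightarrow> 'r fm \<Rightarrow> bool" where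
  "sat M g G (Rel r xs) \<longleftrightarrow> map g xs \<in> interp M r"
| "sat M g G (Eq x y) \<longleftrightarrow> g x = g y"
| "sat M g G (Mem X x) \<longleftrightarrow> g x \<in> G X"
| "sat M g G (Neg \<phi>) \<longleftrightarrow> \<not> sat M g G \<phi>"
| "sat M g G (Conj \<phi> \<psi>) \<longleftrightarrow> sat M g G \<phi> \<and> sat M g G \<psi>"
| "sat M g G (Ex x \<phi>) \<longleftrightarrow> (\<exists>a\<in>domain M. sat M (g(x := a)) G \<phi>)"
| "sat M g G (ExSet X \<phi>) \<longleftrightarrow> (\<exists>B\<in>admissible M. sat M g (G(X := B)) \<phi>)"
| "sat M g G (TC x y \<phi> u v) \<longleftrightarrow>
     (\<forall>B\<in>admissible M.
        g u \<in> B \<and> (\<forall>a\<in>B. \<forall>b\<in>domain M. sat M (g(x := a, y := b)) G \<phi> \<longrightarrow> b \<in> B)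
        \<longrightarrow> g v \<in> B)"
| "sat M g G (LFP X x \<phi> y) \<longleftrightarrow>
     (\<forall>B\<in>admissible M.
        (\<forall>a\<in>domain M. sat M (g(x := a)) (G(X := B)) \<phi> \<longrightarrow> a \<in> B)
        \<longrightarrow> g y \<in> B)"

text \<open>
  \<open>FO_TC\<close> has no set variables, so for that logic the component \<open>G\<close> is irrelevant and
  unconstrained.
\<close>

definition is_assignment ::
  "logic \<Rightarrow> ('r, 'a) frame \<Rightarrow> (nat \<Rightarrow> 'a) \<Rightarrow> (nat \<Rightarrow> 'a set) \<Rightarrow> bool" where
  "is_assignment \<Lambda> M g G \<longleftrightarrow>
     range g \<subseteq> domain M \<and> (\<Lambda> \<noteq> FO_TC \<longrightarrow> range G \<subseteq> admissible M)"

text \<open>The parameters of a definable set are the values of the assignment, on set variables too.\<close>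

definition parametrically_definable ::
  "('r \<Rightarrow> nat) \<Rightarrow> logic \<Rightarrow> ('r, 'a) frame \<Rightarrow> 'a set \<Rightarrow> bool" where
  "parametrically_definable ar \<Lambda> M S \<longleftrightarrow>
     (\<exists>\<phi> x g G. is_formula ar \<Lambda> \<phi> \<and> is_assignment \<Lambda> M g G \<and>
        S = {a \<in> domain M. sat M (g(x := a)) G \<phi>})"

definition henkin_structure :: "('r \<Rightarrow> nat) \<Rightarrow> logic \<Rightarrow> ('r, 'a) frame \<Rightarrow> bool" where
  "henkin_structure ar \<Lambda> M \<longleftrightarrow>
     is_frame ar M \<and> (\<forall>S. parametrically_definable ar \<Lambda> M S \<longrightarrow> S \<in> admissible M)"

definition substructure :: "('r, 'a) frame \<Rightarrow> 'a set \<Rightarrow> ('r, 'a) frame" where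
  "substructure M A =
     \<lparr>domain = A,
      interp = (\<lambda>r. {as \<in> interp M r. set as \<subseteq> A}),
      admissible = {X \<inter> A | X. X \<in> admissible M}\<rparr>"

end

theory Submission
  imports Defs
begin

text \<open>
  Definability in the substructure is reduced to definability in \<open>M\<close> by relativising formulas to a
  formula defining \<open>A\<close>. Since \<open>admissible M\<close> need not be closed under intersection with \<open>A\<close> (for
  \<open>FO_TC\<close>), set variables are not relativised: a value \<open>B\<close> in \<open>M\<close> stands for \<open>B \<inter> A\<close> in the
  substructure, which is harmless because all relevant individuals lie in \<open>A\<close>. Variables of the
  relativised formula are made even and those of the formula defining \<open>A\<close>, apart from the
  variable being tested for membership, odd, so that the
  parameters of the two formulas can coexist in one assignment.
\<close>

primrec rename :: "(nat \<Rightarrow> nat) \<Rightarrow> (nat \<Rightarrow> nat) \<Rightarrow> 'r fm \<Rightarrow> 'r fm" where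
  "rename f F (Rel r xs) = Rel r (map f xs)"
| "rename f F (Eq x y) = Eq (f x) (f y)"
| "rename f F (Mem X x) = Mem (F X) (f x)"
| "rename f F (Neg \<phi>) = Neg (rename f F \<phi>)"
| "rename f F (Conj \<phi> \<psi>) = Conj (rename f F \<phi>) (rename f F \<psi>)"
| "rename f F (Ex x \<phi>) = Ex (f x) (rename f F \<phi>)"
| "rename f F (ExSet X \<phi>) = ExSet (F X) (rename f F \<phi>)"
| "rename f F (TC x y \<phi> u v) = TC (f x) (f y) (rename f F \<phi>) (f u) (f v)"
| "rename f F (LFP X x \<phi> y) = LFP (F X) (f x) (rename f F \<phi>) (f y)"

lemma fun_upd_comp_inj: "inj f \<Longrightarrow> (g(f x := a)) \<circ> f = (g \<circ> f)(x := a)"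
  by (auto simp: fun_eq_iff inj_eq)

text \<open>Bound variables are renamed along with free ones; injectivity rules out capture, since
  an update at \<open>f x\<close> then disturbs no other renamed variable.\<close>

lemma sat_rename:
  assumes "inj f" "inj F"
  shows "sat M g G (rename f F \<phi>) \<longleftrightarrow> sat M (g \<circ> f) (G \<circ> F) \<phi>"
  by (induction \<phi> arbitrary: g G) (simp_all add: fun_upd_comp_inj assms)

lemma polarity_rename:
  assumes "inj F"
  shows "polarity b (F X) (rename f F \<phi>) \<longleftrightarrow> polarity b X \<phi>"
  by (induction \<phi> arbitrary: b) (simp_all add: inj_eq assms)

lemma polarity_rename_fresh: "X \<notin> range F \<Longrightarrow> polarity b X (rename f F \<phi>)"
  by (induction \<phi> arbitrary: b) auto

lemma is_formula_rename:
  assumes "inj f" "inj F" "is_formula ar \<Lambda> \<phi>"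
  shows "is_formula ar \<Lambda> (rename f F \<phi>)"
  using assms(3) by (induction \<phi>) (auto simp: assms(1,2) inj_eq polarity_rename)

text \<open>Without set variables the set assignment is never consulted, so in this logic it may be
  replaced at will.\<close>

lemma sat_FO_TC_cong: "is_formula ar FO_TC \<phi> \<Longrightarrow> sat M g G \<phi> \<longleftrightarrow> sat M g G' \<phi>"
  by (induction \<phi> arbitrary: g) auto

text \<open>Packs two assignments into one: even positions serve the relativised formula, odd
  positions hold the parameters of the formula defining \<open>A\<close>.\<close>

definition interleave :: "(nat \<Rightarrow> 'b) \<Rightarrow> (nat \<Rightarrow> 'b) \<Rightarrow> nat \<Rightarrow> 'b" where
  "interleave g p n = (if even n then g (n div 2) else p (n div 2))"

lemma interleave_even [simp]: "interleave g p (2 * n) = g n"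
  and interleave_odd [simp]: "interleave g p (Suc (2 * n)) = p n"
  by (simp_all add: interleave_def)

lemma interleave_upd [simp]: "(interleave g p)(2 * n := a) = interleave (g(n := a)) p"
  by (auto simp: fun_eq_iff interleave_def)

lemma range_interleave_subset: "range g \<subseteq> D \<Longrightarrow> range p \<subseteq> D \<Longrightarrow> range (interleave g p) \<subseteq> D"
  by (auto simp: interleave_def)

text \<open>\<open>\<theta> y\<close> is meant to say that the (even) variable \<open>2 * y\<close> denotes an element of \<open>A\<close>.\<close>

primrec relativize :: "(nat \<Rightarrow> 'r fm) \<Rightarrow> 'r fm \<Rightarrow> 'r fm" where
  "relativize \<theta> (Rel r xs) = Rel r (map ((*) 2) xs)"
| "relativize \<theta> (Eq x y) = Eq (2 * x) (2 * y)"
| "relativize \<theta> (Mem X x) = Mem (2 * X) (2 * x)"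
| "relativize \<theta> (Neg \<phi>) = Neg (relativize \<theta> \<phi>)"
| "relativize \<theta> (Conj \<phi> \<psi>) = Conj (relativize \<theta> \<phi>) (relativize \<theta> \<psi>)"
| "relativize \<theta> (Ex x \<phi>) = Ex (2 * x) (Conj (\<theta> x) (relativize \<theta> \<phi>))"
| "relativize \<theta> (ExSet X \<phi>) = ExSet (2 * X) (relativize \<theta> \<phi>)"
| "relativize \<theta> (TC x y \<phi> u v) =
     TC (2 * x) (2 * y) (Conj (\<theta> x) (Conj (\<theta> y) (relativize \<theta> \<phi>))) (2 * u) (2 * v)"
| "relativize \<theta> (LFP X x \<phi> y) = LFP (2 * X) (2 * x) (Conj (\<theta> x) (relativize \<theta> \<phi>)) (2 * y)"

lemma polarity_relativize:
  assumes "\<And>b y. polarity b (2 * X) (\<theta> y)" "polarity b X \<phi>"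
  shows "polarity b (2 * X) (relativize \<theta> \<phi>)"
  using assms(2) by (induction \<phi> arbitrary: b) (auto simp: assms(1))

text \<open>The delicate case is \<open>LFP\<close>: the guards are neutral in even set variables,
  so adding them preserves positivity.\<close>

lemma is_formula_relativize:
  assumes "\<And>b X y. polarity b (2 * X) (\<theta> y)" "\<And>y. is_formula ar \<Lambda> (\<theta> y)" "is_formula ar \<Lambda> \<phi>"
  shows "is_formula ar \<Lambda> (relativize \<theta> \<phi>)"
  using assms by (induction \<phi>) (auto simp: polarity_relativize)

lemma substructure_simps [simp]:
  "domain (substructure M A) = A"
  "interp (substructure M A) r = {as \<in> interp M r. set as \<subseteq> A}"
  "admissible (substructure M A) = (\<lambda>B. B \<inter> A) ` admissible M"
  by (auto simp: substructure_def)

text \<open>The admissible sets of the substructure are exactly the traces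
  \<open>B \<inter> A\<close>, so set quantification matches on both sides. No condition on
  \<open>G\<close> is imposed, which lets the induction hypothesis apply after any set
  update.\<close>

lemma sat_relativize:
  assumes frame: "is_frame ar M" and A: "A \<subseteq> domain M"
    and \<theta>: "\<And>g G y. g y \<in> domain M \<Longrightarrow>
               sat M (interleave g p) (interleave G P) (\<theta> y) \<longleftrightarrow> g y \<in> A"
    and g: "range g \<subseteq> A" and \<phi>: "is_formula ar \<Lambda> \<phi>"
  shows "sat M (interleave g p) (interleave G P) (relativize \<theta> \<phi>) \<longleftrightarrow>
         sat (substructure M A) g (\<lambda>X. G X \<inter> A) \<phi>"
  using g \<phi>
proof (induction \<phi> arbitrary: g G)
  case (Rel r xs)
  have "map (interleave g p) (map ((*) 2) xs) = map g xs" by simp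
  moreover have "set (map g xs) \<subseteq> A" using Rel by auto
  ultimately show ?case by (simp del: map_map)
next
  case (Mem X x)
  then show ?case by auto
next
  case (Ex x \<phi>)
  have "sat M (interleave (g(x := a)) p) (interleave G P) (relativize \<theta> \<phi>)
      \<longleftrightarrow> sat (substructure M A) (g(x := a)) (\<lambda>X. G X \<inter> A) \<phi>" if "a \<in> A" for a
    using that Ex.prems by (intro Ex.IH) auto
  moreover have "sat M (interleave (g(x := a)) p) (interleave G P) (\<theta> x) \<longleftrightarrow> a \<in> A"
    if "a \<in> domain M" for a
    using \<theta>[of "g(x := a)" x] that by simp
  ultimately show ?case using A by auto
next
  case (ExSet X \<phi>)
  have "(\<lambda>Y. G Y \<inter> A)(X := B \<inter> A) = (\<lambda>Y. (G(X := B)) Y \<inter> A)" for B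
    by (simp add: fun_eq_iff)
  moreover have "is_formula ar \<Lambda> \<phi>" using ExSet.prems by auto
  ultimately show ?case using ExSet.IH[OF ExSet.prems(1)] by (simp del: fun_upd_apply)
next
  case (TC x y \<phi> u v)
  have uv: "g u \<in> A" "g v \<in> A" and "x \<noteq> y" using TC.prems by auto
  have IH: "sat M (interleave (g(x := a, y := b)) p) (interleave G P) (relativize \<theta> \<phi>)
      \<longleftrightarrow> sat (substructure M A) (g(x := a, y := b)) (\<lambda>X. G X \<inter> A) \<phi>"
    if "a \<in> A" "b \<in> A" for a b
    using that TC.prems by (intro TC.IH) auto
  \<comment> \<open>As \<open>x \<noteq> y\<close>, the second update leaves the value
    \<open>a\<close> of \<open>x\<close> intact, so each guard tests its own variable.\<close>
  have guards: "sat M (interleave (g(x := a, y := b)) p) (interleave G P) (\<theta> x) \<longleftrightarrow> a \<in> A"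
      "sat M (interleave (g(x := a, y := b)) p) (interleave G P) (\<theta> y) \<longleftrightarrow> b \<in> A"
    if "a \<in> domain M" "b \<in> domain M" for a b
    using \<theta>[of "g(x := a, y := b)"] that \<open>x \<noteq> y\<close> by simp_all
  \<comment> \<open>Pairs leaving \<open>A\<close> fail a guard and impose no closure condition, so
    closure of \<open>B\<close> depends only on its trace on \<open>A\<close>.\<close>
  have closed_iff:
    "(\<forall>a\<in>B. \<forall>b\<in>domain M. sat M (interleave (g(x := a, y := b)) p) (interleave G P)
         (Conj (\<theta> x) (Conj (\<theta> y) (relativize \<theta> \<phi>))) \<longrightarrow> b \<in> B) \<longleftrightarrow>
     (\<forall>a\<in>B \<inter> A. \<forall>b\<in>A. sat (substructure M A) (g(x := a, y := b)) (\<lambda>X. G X \<inter> A) \<phi>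
         \<longrightarrow> b \<in> B \<inter> A)"
    if "B \<in> admissible M" for B
  proof -
    \<comment> \<open>The guards are known to be correct only for individuals of \<open>M\<close>,
      and here \<open>a\<close> ranges over \<open>B\<close>.\<close>
    have "B \<subseteq> domain M" using frame that by (auto simp: is_frame_def)
    then show ?thesis using A by (auto simp: subset_iff guards IH)
  qed
  show ?case using uv by (simp add: closed_iff del: sat.simps(5))
next
  case (LFP X x \<phi> y)
  have y: "g y \<in> A" using LFP.prems by auto
  have IH: "sat M (interleave (g(x := a)) p) (interleave (G(X := B)) P) (relativize \<theta> \<phi>)
      \<longleftrightarrow> sat (substructure M A) (g(x := a)) (\<lambda>Y. (G(X := B)) Y \<inter> A) \<phi>" if "a \<in> A" for a B
    using that LFP.prems by (intro LFP.IH) auto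
  have upd: "(\<lambda>Y. G Y \<inter> A)(X := B \<inter> A) = (\<lambda>Y. (G(X := B)) Y \<inter> A)" for B
    by (simp add: fun_eq_iff)
  have guard: "sat M (interleave (g(x := a)) p) (interleave (G(X := B)) P) (\<theta> x) \<longleftrightarrow> a \<in> A"
    if "a \<in> domain M" for a B
    using \<theta>[of "g(x := a)" x] that by simp
  \<comment> \<open>The guard restricts \<open>a\<close> to \<open>A\<close>, where membership in
    \<open>B\<close> and in \<open>B \<inter> A\<close> coincide.\<close>
  have closed_iff:
    "(\<forall>a\<in>domain M. sat M (interleave (g(x := a)) p) (interleave (G(X := B)) P)
         (Conj (\<theta> x) (relativize \<theta> \<phi>)) \<longrightarrow> a \<in> B) \<longleftrightarrow>
     (\<forall>a\<in>A. sat (substructure M A) (g(x := a)) ((\<lambda>Y. G Y \<inter> A)(X := B \<inter> A)) \<phi>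
         \<longrightarrow> a \<in> B \<inter> A)" for B
    unfolding upd using A by (auto simp: subset_iff guard IH simp del: fun_upd_apply)
  show ?case using y by (simp add: closed_iff del: sat.simps(5) fun_upd_apply)
qed simp_all

theorem theorem5p5:
  fixes ar :: "'r \<Rightarrow> nat" and \<Lambda> :: logic
    and M :: "('r, 'a) frame" and A :: "'a set"
  assumes "henkin_structure ar \<Lambda> M"
    and "A \<in> admissible M"
    and "parametrically_definable ar \<Lambda> M A"
  shows "henkin_structure ar \<Lambda> (substructure M A)"
proof -
  let ?N = "substructure M A"
  have frame: "is_frame ar M"
    and closed: "\<And>S. parametrically_definable ar \<Lambda> M S \<Longrightarrow> S \<in> admissible M"
    using assms(1) by (auto simp: henkin_structure_def)
  obtain \<alpha> z p P where \<alpha>: "is_formula ar \<Lambda> \<alpha>" and pP: "is_assignment \<Lambda> M p P"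
    and A_eq: "A = {a \<in> domain M. sat M (p(z := a)) P \<alpha>}"
    using assms(3) by (auto simp: parametrically_definable_def)
  have A_sub: "A \<subseteq> domain M" using A_eq by auto
  \<comment> \<open>Only the tested variable \<open>z\<close> goes to an even index, that of
    \<open>y\<close>; all others go to odd indices, where \<open>interleave\<close> keeps the values
    of \<open>p\<close>.\<close>
  define f where "f y n = (if n = z then 2 * y else Suc (2 * n))" for y n :: nat
  define F where "F X = Suc (2 * X)" for X :: nat
  define \<theta> where "\<theta> y = rename (f y) F \<alpha>" for y
  have inj_f: "inj (f y)" for y
    by (auto simp: inj_def f_def split: if_splits) presburger+
  have inj_F: "inj F" by (simp add: inj_def F_def)
  have \<theta>_pol: "polarity b (2 * X) (\<theta> y)" for b X y
    unfolding \<theta>_def by (rule polarity_rename_fresh) (auto simp: F_def, presburger)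
  have \<theta>_fm: "is_formula ar \<Lambda> (\<theta> y)" for y
    unfolding \<theta>_def by (intro is_formula_rename inj_f inj_F \<alpha>)
  have \<theta>_sat: "sat M (interleave g p) (interleave G P) (\<theta> y) \<longleftrightarrow> g y \<in> A"
    if "g y \<in> domain M" for g G y
  proof -
    have "interleave g p \<circ> f y = p(z := g y)" "interleave G P \<circ> F = P"
      by (auto simp: fun_eq_iff f_def F_def)
    then show ?thesis using that by (simp add: \<theta>_def sat_rename inj_f inj_F A_eq)
  qed
  have "S \<in> admissible ?N" if S_def: "parametrically_definable ar \<Lambda> ?N S" for S
  proof -
    obtain \<phi> x g G where \<phi>: "is_formula ar \<Lambda> \<phi>" and gG: "is_assignment \<Lambda> ?N g G"
      and S: "S = {a \<in> A. sat ?N (g(x := a)) G \<phi>}"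
      using S_def by (auto simp: parametrically_definable_def)
    have g: "range g \<subseteq> A" using gG by (simp add: is_assignment_def)
    \<comment> \<open>\<open>H\<close> lifts the set parameters to \<open>M\<close>: each is the
      trace of some admissible set. For \<open>FO_TC\<close> they need not be traces, but any choice
      works there.\<close>
    obtain H where H: "\<Lambda> \<noteq> FO_TC \<Longrightarrow> range H \<subseteq> admissible M"
      and G: "\<And>h. sat ?N h G \<phi> \<longleftrightarrow> sat ?N h (\<lambda>X. H X \<inter> A) \<phi>"
    proof (cases "\<Lambda> = FO_TC")
      case True
      then show thesis using that[of G] \<phi> sat_FO_TC_cong by blast
    next
      case False
      then have "range G \<subseteq> (\<lambda>B. B \<inter> A) ` admissible M"
        using gG by (simp add: is_assignment_def)
      then have "\<forall>X. \<exists>B. B \<in> admissible M \<and> G X = B \<inter> A" by blast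
      then obtain H where "\<forall>X. H X \<in> admissible M \<and> G X = H X \<inter> A"
        by (auto dest!: choice)
      then have "range H \<subseteq> admissible M" "G = (\<lambda>X. H X \<inter> A)" by auto
      then show thesis using that[of H] by simp
    qed
    \<comment> \<open>The extra guard cuts the defined set down to \<open>A\<close>, since its free
      variable now ranges over the domain of \<open>M\<close>.\<close>
    let ?\<psi> = "Conj (\<theta> x) (relativize \<theta> \<phi>)"
    have "is_formula ar \<Lambda> ?\<psi>"
      using \<theta>_fm is_formula_relativize[OF \<theta>_pol \<theta>_fm \<phi>] by simp
    moreover have "is_assignment \<Lambda> M (interleave g p) (interleave H P)"
      using pP subset_trans[OF g A_sub] H
      by (simp add: is_assignment_def range_interleave_subset)
    moreover have "S = {a \<in> domain M. sat M ((interleave g p)(2 * x := a)) (interleave H P) ?\<psi>}"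
    proof -
      have "sat M (interleave (g(x := a)) p) (interleave H P) (relativize \<theta> \<phi>) \<longleftrightarrow>
          sat ?N (g(x := a)) G \<phi>" if "a \<in> A" for a
        unfolding G using that g by (intro sat_relativize[OF frame A_sub \<theta>_sat _ \<phi>]) auto
      then show ?thesis using A_sub by (auto simp: S \<theta>_sat)
    qed
    ultimately have "S \<in> admissible M"
      by (intro closed) (unfold parametrically_definable_def, blast)
    \<comment> \<open>Lying inside \<open>A\<close>, the set \<open>S\<close> is its own trace,
      hence admissible in the substructure.\<close>
    moreover have "S = S \<inter> A" using S by auto
    ultimately show ?thesis by auto
  qed
  moreover have "is_frame ar ?N" using frame by (auto simp: is_frame_def)
  ultimately show ?thesis by (simp add: henkin_structure_def)
qed

end
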